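(* Let $n,\ell$ be positive integers and let $m$ be a non-negative integer. Then $s^*(n,\ell,m)=\tilde{s}(n,\ell,m)$.
   Context: $[n]=\{1,\dots,n\}$ and $2^{[n]}$ is the set of all subsets of $[n]$. Families $\mathcal{F}_1,\dots,\mathcal{F}_\ell\subset 2^{[n]}$ satisfy the $m$-overlapping property if for any distinct $k_1,k_2\in[\ell]$ and any $F_1\in\mathcal{F}_{k_1}$, $F_2\in\mathcal{F}_{k_2}$ one has $|F_1\cap F_2|\le m$. The number $s^*(n,\ell,m)$ is the maximum of $|\mathcal{F}_1|\cdots|\mathcal{F}_\ell|$ over all families $\mathcal{F}_1,\dots,\mathcal{F}_\ell\subset 2^{[n]}$ with the $m$-overlapping property. Let $H$ be the complete $(m+1)$-uniform hypergraph on vertex set $[n]$ (its edges are all $(m+1)$-element subsets of $[n]$). Given a coloring of the edges of $H$ into $\ell$ colors (each edge gets exactly one color in $[\ell]$; not all colors need be used), a monochromatic clique of color $i$ is a set $K\subset[n]$ all of whose $(m+1)$-element subsets have color $i$; in particular every set of at most $m$ vertices is a monochromatic clique in each color. Let $k_i$ be the number of monochromatic cliques of color $i$. The number $\tilde{s}(n,\ell,m)$ is the maximum of $k_1\cdots k_\ell$ over all such colorings. *)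

theory Defs
  imports Main "HOL-Library.FuncSet" "HOL-Library.Ramsey"
begin

definition overlapping :: "nat \<Rightarrow> nat \<Rightarrow> (nat \<Rightarrow> nat set set) \<Rightarrow> bool" where
  "overlapping l m F \<longleftrightarrow>
     (\<forall>k1\<in>{1..l}. \<forall>k2\<in>{1..l}. k1 \<noteq> k2 \<longrightarrow>
        (\<forall>F1\<in>F k1. \<forall>F2\<in>F k2. card (F1 \<inter> F2) \<le> m))"

definition overlapping_families :: "nat \<Rightarrow> nat \<Rightarrow> nat \<Rightarrow> (nat \<Rightarrow> nat set set) set" where
  "overlapping_families n l m = {F. (\<forall>k\<in>{1..l}. F k \<subseteq> Pow {1..n}) \<and> overlapping l m F}"

definition family_products :: "nat \<Rightarrow> nat \<Rightarrow> nat \<Rightarrow> nat set" where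
  "family_products n l m = (\<lambda>F. \<Prod>k\<in>{1..l}. card (F k)) ` overlapping_families n l m"

definition s_star :: "nat \<Rightarrow> nat \<Rightarrow> nat \<Rightarrow> nat" where
  "s_star n l m = Max (family_products n l m)"

text \<open>The values of a coloring outside the edge set are irrelevant: cliques only inspect edges.\<close>

definition edge_colorings :: "nat \<Rightarrow> nat \<Rightarrow> nat \<Rightarrow> (nat set \<Rightarrow> nat) set" where
  "edge_colorings n l m = nsets {1..n} (m + 1) \<rightarrow> {1..l}"

definition mono_cliques :: "nat \<Rightarrow> nat \<Rightarrow> (nat set \<Rightarrow> nat) \<Rightarrow> nat \<Rightarrow> nat set set" where
  "mono_cliques n m c i = {K. K \<subseteq> {1..n} \<and> (\<forall>e\<in>nsets K (m + 1). c e = i)}"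

definition clique_products :: "nat \<Rightarrow> nat \<Rightarrow> nat \<Rightarrow> nat set" where
  "clique_products n l m = (\<lambda>c. \<Prod>i\<in>{1..l}. card (mono_cliques n m c i)) ` edge_colorings n l m"

definition s_tilde :: "nat \<Rightarrow> nat \<Rightarrow> nat \<Rightarrow> nat" where
  "s_tilde n l m = Max (clique_products n l m)"

text \<open>Both maxima are taken over finite nonempty sets, hence are attained.\<close>

lemma prod_card_Pow_le:
  fixes F :: "nat \<Rightarrow> nat set set"
  assumes "\<And>k. k \<in> {1..l} \<Longrightarrow> F k \<subseteq> Pow {1..n}"
  shows "(\<Prod>k\<in>{1..l}. card (F k)) \<le> (2 ^ n) ^ l"
proof -
  have "card (F k) \<le> 2 ^ n" if "k \<in> {1..l}" for k
    using card_mono[OF _ assms[OF that]] by (simp add: card_Pow)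
  then have "(\<Prod>k\<in>{1..l}. card (F k)) \<le> (\<Prod>k\<in>{1..l}. 2 ^ n)"
    by (intro prod_mono) auto
  then show ?thesis by simp
qed

lemma finite_family_products: "finite (family_products n l m)"
proof (rule finite_subset)
  show "family_products n l m \<subseteq> {..(2 ^ n) ^ l}"
    unfolding family_products_def overlapping_families_def
    using prod_card_Pow_le by blast
qed simp

lemma family_products_nonempty: "family_products n l m \<noteq> {}"
proof -
  have "(\<lambda>_. {}) \<in> overlapping_families n l m"
    by (simp add: overlapping_families_def overlapping_def)
  then show ?thesis by (auto simp: family_products_def)
qed

lemma finite_clique_products: "finite (clique_products n l m)"
proof (rule finite_subset)
  show "clique_products n l m \<subseteq> {..(2 ^ n) ^ l}"
  proof -
    have "(\<Prod>i\<in>{1..l}. card (mono_cliques n m c i)) \<le> (2 ^ n) ^ l" for c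
      by (rule prod_card_Pow_le) (auto simp: mono_cliques_def)
    then show ?thesis unfolding clique_products_def by blast
  qed
qed simp

lemma clique_products_nonempty:
  assumes "l \<ge> 1"
  shows "clique_products n l m \<noteq> {}"
proof -
  have "(\<lambda>_. 1) \<in> edge_colorings n l m"
    using assms by (simp add: edge_colorings_def)
  then show ?thesis by (auto simp: clique_products_def)
qed

end

(* The monochromatic cliques of any coloring are themselves m-overlapping families: a larger
   intersection would contain an edge of two colors. Conversely, overlapping families determine a
   coloring by giving an edge the (unique) index of a family with a member containing it; every
   member of the k-th family is then a clique of color k. *)
theory Submission
  imports Defs
begin

lemma mono_cliques_overlapping:
  "mono_cliques n m c \<in> overlapping_families n l m"
proof -
  have "card (K1 \<inter> K2) \<le> m"
    if "k1 \<noteq> k2" "K1 \<in> mono_cliques n m c k1" "K2 \<in> mono_cliques n m c k2" for k1 k2 K1 K2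
  proof (rule ccontr)
    assume "\<not> card (K1 \<inter> K2) \<le> m"
    then obtain e where "e \<subseteq> K1 \<inter> K2" "card e = m + 1" "finite e"
      using obtain_subset_with_card_n[of "m + 1" "K1 \<inter> K2"] by auto
    then have "e \<in> nsets K1 (m + 1)" "e \<in> nsets K2 (m + 1)"
      by (auto simp: nsets_def)
    with that have "c e = k1" "c e = k2"
      by (auto simp: mono_cliques_def)
    with \<open>k1 \<noteq> k2\<close> show False by simp
  qed
  then show ?thesis
    by (auto simp: overlapping_families_def overlapping_def mono_cliques_def)
qed

text \<open>A common edge would lie in \<open>F1 \<inter> F2\<close> and force at least
  \<open>m + 1\<close> points there. This uniqueness makes a coloring read off from the families
  independent of choices.\<close>

lemma overlapping_edge_unique:
  assumes "F \<in> overlapping_families n l m" "k1 \<in> {1..l}" "k2 \<in> {1..l}"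
    and "F1 \<in> F k1" "F2 \<in> F k2" "e \<in> nsets F1 (m + 1)" "e \<in> nsets F2 (m + 1)"
  shows "k1 = k2"
proof (rule ccontr)
  assume "k1 \<noteq> k2"
  then have "card (F1 \<inter> F2) \<le> m"
    using assms by (auto simp: overlapping_families_def overlapping_def)
  \<comment> \<open>The ground set supplies the finiteness that monotonicity of \<open>card\<close>
    requires.\<close>
  moreover have "F1 \<subseteq> {1..n}"
    using assms(1,2,4) unfolding overlapping_families_def by blast
  then have "finite (F1 \<inter> F2)"
    using finite_subset by blast
  then have "card e \<le> card (F1 \<inter> F2)"
    using assms(6,7) by (intro card_mono) (auto simp: nsets_def)
  ultimately show False
    using assms(6) by (simp add: nsets_def)
qed

text \<open>Inclusion suffices for comparing products: passing from \<open>F k\<close> to all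
  cliques of color \<open>k\<close> can only enlarge each factor.\<close>

lemma overlapping_families_extend_to_cliques:
  assumes F: "F \<in> overlapping_families n l m" and l: "l \<ge> 1"
  obtains c where "c \<in> edge_colorings n l m"
    and "\<And>k. k \<in> {1..l} \<Longrightarrow> F k \<subseteq> mono_cliques n m c k"
proof -
  define P where "P e k \<longleftrightarrow> k \<in> {1..l} \<and> (\<exists>A\<in>F k. e \<in> nsets A (m + 1))" for e k
  \<comment> \<open>Edges inside no member are unconstrained; the default 1 is a legal color because
    \<open>l \<ge> 1\<close>.\<close>
  define c where "c e = (if \<exists>k. P e k then SOME k. P e k else 1)" for e
  have c_P: "P e (c e)" if "P e k" for e k
    using that unfolding c_def by (auto intro: someI)
  have c_range: "c e \<in> {1..l}" for e
  proof (cases "\<exists>k. P e k")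
    case True
    then show ?thesis using c_P by (auto simp: P_def)
  qed (use l in \<open>simp add: c_def\<close>)
  have "F k \<subseteq> mono_cliques n m c k" if k: "k \<in> {1..l}" for k
  proof
    fix A assume A: "A \<in> F k"
    have "c e = k" if "e \<in> nsets A (m + 1)" for e
    proof -
      have "P e k" using k A that by (auto simp: P_def)
      \<comment> \<open>The chosen index also has a member containing \<open>e\<close>, so
        uniqueness identifies it with \<open>k\<close>.\<close>
      with c_P have "P e (c e)" by blast
      with \<open>P e k\<close> show ?thesis
        unfolding P_def using overlapping_edge_unique[OF F] by blast
    qed
    moreover have "A \<subseteq> {1..n}"
      using F k A unfolding overlapping_families_def by blast
    ultimately show "A \<in> mono_cliques n m c k"
      by (simp add: mono_cliques_def)
  qed
  with c_range show thesis
    by (intro that[of c]) (auto simp: edge_colorings_def)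
qed

theorem proposition4:
  fixes n l m :: nat
  assumes "n \<ge> 1" and "l \<ge> 1"
  shows "s_star n l m = s_tilde n l m"
proof (rule antisym)
  show "s_tilde n l m \<le> s_star n l m"
    unfolding s_star_def s_tilde_def
  proof (rule Max_mono)
    show "clique_products n l m \<subseteq> family_products n l m"
      unfolding clique_products_def family_products_def
      using mono_cliques_overlapping by blast
  \<comment> \<open>Here \<open>l \<ge> 1\<close> ensures that some coloring exists, so that the
    smaller maximum is over a nonempty set.\<close>
  qed (use assms clique_products_nonempty finite_family_products in auto)
  have "p \<le> s_tilde n l m" if "p \<in> family_products n l m" for p
  proof -
    from that obtain F where F: "F \<in> overlapping_families n l m"
      and p: "p = (\<Prod>k\<in>{1..l}. card (F k))"
      by (auto simp: family_products_def)
    obtain c where c: "c \<in> edge_colorings n l m"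
      and sub: "\<And>k. k \<in> {1..l} \<Longrightarrow> F k \<subseteq> mono_cliques n m c k"
      using overlapping_families_extend_to_cliques[OF F \<open>l \<ge> 1\<close>] by blast
    \<comment> \<open>Finiteness turns the inclusions \<open>sub\<close> into inequalities between
      the factors.\<close>
    have "finite (mono_cliques n m c k)" for k
      by (rule finite_subset[of _ "Pow {1..n}"]) (auto simp: mono_cliques_def)
    then have "p \<le> (\<Prod>k\<in>{1..l}. card (mono_cliques n m c k))"
      unfolding p using sub by (intro prod_mono) (auto intro: card_mono)
    also have "\<dots> \<le> s_tilde n l m"
      unfolding s_tilde_def using c
      by (intro Max_ge finite_clique_products) (auto simp: clique_products_def)
    finally show ?thesis .
  qed
  then show "s_star n l m \<le> s_tilde n l m"
    unfolding s_star_def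
    using finite_family_products family_products_nonempty by simp
qed

end
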